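(* Let $(V,V^+)$ be an ordered real vector space with order unit $e$, and let $J$ be an order ideal of $V$. Define $$N_J := \{ v \in V : \text{for all } r > 0 \text{ there exist } j,k \in J \text{ such that } j+re+v \in V^+ \text{ and } k + re - v \in V^+ \}.$$ Then $N_J$ is an order ideal of $V$. Furthermore, if $$(V/N_J)^+ := \{ v + N_J : \text{for all } r > 0 \text{ there exists } j \in J \text{ such that } j + re + v \in V^+ \},$$ then $(V/N_J, (V/N_J)^+ )$ is an ordered real vector space with Archimedean order unit $e + N_J$, and this space is unitally order isomorphic to the Archimedean quotient of $V$ by $J$.
   Context: An ordered real vector space $(V,V^+)$ is a real vector space $V$ with a nonempty subset $V^+\subseteq V$ closed under addition and under multiplication by scalars in $[0,\infty)$, such that $V^+\cap -V^+=\{0\}$. One writes $v\ge w$ if $v-w\in V^+$. An element $e\in V$ is an order unit if for each $v\in V$ there is a real $r>0$ with $re\ge v$; it is an Archimedean order unit if, in addition, whenever $v\in V$ satisfies $re+v\ge 0$ for all real $r>0$, then $v\in V^+$. A subspace $J\subseteq V$ is an order ideal if $p\in J$ and $0\le q\le p$ imply $q\in J$. For an order ideal $J$, the quotient $(V/J, V^++J)$, where $V^++J=\{v+J: v\in V^+\}$, is an ordered real vector space with order unit $e+J$. Two ordered vector spaces with order units are unitally order isomorphic if there is a linear bijection $\phi$ between them mapping order unit to order unit such that $v$ is positive if and only if $\phi(v)$ is positive. Archimedeanization: for an ordered real vector space $(U,U^+)$ with order unit $u$, let $D := \{ v \in U : ru + v \in U^+ \text{ for all real } r >0 \}$ and $N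 := D \cap -D$ (a subspace). The Archimedeanization of $U$ is $U/N$ with cone $\{v+N: v\in D\}$ and (Archimedean) order unit $u+N$. The Archimedean quotient of $V$ by $J$ is the Archimedeanization of $(V/J, V^++J)$ with order unit $e+J$. *)

theory Defs
  imports "HOL-Algebra.Algebraic_Closure_Type"
begin

text \<open>Ordered real vector spaces are carrier-based, so that a space and its (iterated) quotients
  are objects of the same kind. The \<open>mult\<close> and \<open>one\<close> fields inherited from the module record
  carry no meaning.\<close>

abbreviation real_ring :: "real ring" where
  "real_ring \<equiv> ring_of_type_algebra"

record 'a ordered_space = "(real, 'a) module" +
  pos_cone :: "'a set"

definition geq :: "'a ordered_space \<Rightarrow> 'a \<Rightarrow> 'a \<Rightarrow> bool" (infix \<open>\<succeq>\<index>\<close> 50) where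
  "v \<succeq>\<^bsub>V\<^esub> w \<longleftrightarrow> v \<ominus>\<^bsub>V\<^esub> w \<in> pos_cone V"

locale ordered_real_vector_space =
  Module.module real_ring V for V :: "'a ordered_space" (structure) +
  assumes cone_subset: "pos_cone V \<subseteq> carrier V"
    and cone_nonempty: "pos_cone V \<noteq> {}"
    and cone_add: "\<lbrakk>v \<in> pos_cone V; w \<in> pos_cone V\<rbrakk> \<Longrightarrow> v \<oplus> w \<in> pos_cone V"
    and cone_smult: "\<lbrakk>0 \<le> r; v \<in> pos_cone V\<rbrakk> \<Longrightarrow> r \<odot> v \<in> pos_cone V"
    and cone_proper: "pos_cone V \<inter> {\<ominus> v | v. v \<in> pos_cone V} = {\<zero>}"

definition order_unit :: "'a ordered_space \<Rightarrow> 'a \<Rightarrow> bool" where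
  "order_unit V e \<longleftrightarrow> e \<in> carrier V \<and> (\<forall>v\<in>carrier V. \<exists>r>0. r \<odot>\<^bsub>V\<^esub> e \<succeq>\<^bsub>V\<^esub> v)"

definition archimedean_order_unit :: "'a ordered_space \<Rightarrow> 'a \<Rightarrow> bool" where
  "archimedean_order_unit V e \<longleftrightarrow> order_unit V e \<and>
    (\<forall>v\<in>carrier V. (\<forall>r>0. r \<odot>\<^bsub>V\<^esub> e \<oplus>\<^bsub>V\<^esub> v \<succeq>\<^bsub>V\<^esub> \<zero>\<^bsub>V\<^esub>) \<longrightarrow> v \<in> pos_cone V)"

definition order_ideal :: "'a ordered_space \<Rightarrow> 'a set \<Rightarrow> bool" where
  "order_ideal V J \<longleftrightarrow> submodule J real_ring V \<and>
    (\<forall>p\<in>J. \<forall>q\<in>carrier V. q \<succeq>\<^bsub>V\<^esub> \<zero>\<^bsub>V\<^esub> \<and> p \<succeq>\<^bsub>V\<^esub> q \<longrightarrow> q \<in> J)"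

text \<open>The quotient \<open>V/N\<close> with cone \<open>{v + N | v \<in> P}\<close>; the product of \<open>r\<close> and
  the coset \<open>C = v + N\<close> is \<open>rv + N\<close>, written as a union so as not to choose a representative.\<close>

definition quotient_space :: "'a ordered_space \<Rightarrow> 'a set \<Rightarrow> 'a set \<Rightarrow> 'a set ordered_space" where
  "quotient_space V N P =
    \<lparr>carrier = a_rcosets\<^bsub>V\<^esub> N, monoid.mult = undefined, one = undefined, ring.zero = N, add = set_add V,
     module.smult = (\<lambda>r C. \<Union>x\<in>C. N +>\<^bsub>V\<^esub> (r \<odot>\<^bsub>V\<^esub> x)),
     pos_cone = {N +>\<^bsub>V\<^esub> v | v. v \<in> P}\<rparr>"

definition order_quotient :: "'a ordered_space \<Rightarrow> 'a set \<Rightarrow> 'a set ordered_space" where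
  "order_quotient V J = quotient_space V J (pos_cone V)"

definition arch_D :: "'a ordered_space \<Rightarrow> 'a \<Rightarrow> 'a set" where
  "arch_D U u = {v \<in> carrier U. \<forall>r>0. r \<odot>\<^bsub>U\<^esub> u \<oplus>\<^bsub>U\<^esub> v \<in> pos_cone U}"

definition arch_N :: "'a ordered_space \<Rightarrow> 'a \<Rightarrow> 'a set" where
  "arch_N U u = arch_D U u \<inter> {\<ominus>\<^bsub>U\<^esub> v | v. v \<in> arch_D U u}"

definition archimedeanization :: "'a ordered_space \<Rightarrow> 'a \<Rightarrow> 'a set ordered_space" where
  "archimedeanization U u = quotient_space U (arch_N U u) (arch_D U u)"

definition archimedeanization_unit :: "'a ordered_space \<Rightarrow> 'a \<Rightarrow> 'a set" where
  "archimedeanization_unit U u = arch_N U u +>\<^bsub>U\<^esub> u"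

definition archimedean_quotient :: "'a ordered_space \<Rightarrow> 'a \<Rightarrow> 'a set \<Rightarrow> 'a set set ordered_space" where
  "archimedean_quotient V e J = archimedeanization (order_quotient V J) (J +>\<^bsub>V\<^esub> e)"

definition archimedean_quotient_unit :: "'a ordered_space \<Rightarrow> 'a \<Rightarrow> 'a set \<Rightarrow> 'a set set" where
  "archimedean_quotient_unit V e J = archimedeanization_unit (order_quotient V J) (J +>\<^bsub>V\<^esub> e)"

definition unitally_order_isomorphic ::
    "'a ordered_space \<Rightarrow> 'a \<Rightarrow> 'b ordered_space \<Rightarrow> 'b \<Rightarrow> bool" where
  "unitally_order_isomorphic V e W f \<longleftrightarrow>
    (\<exists>\<phi>. bij_betw \<phi> (carrier V) (carrier W) \<and>
      (\<forall>v\<in>carrier V. \<forall>w\<in>carrier V. \<phi> (v \<oplus>\<^bsub>V\<^esub> w) = \<phi> v \<oplus>\<^bsub>W\<^esub> \<phi> w) \<and>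
      (\<forall>r. \<forall>v\<in>carrier V. \<phi> (r \<odot>\<^bsub>V\<^esub> v) = r \<odot>\<^bsub>W\<^esub> \<phi> v) \<and>
      \<phi> e = f \<and>
      (\<forall>v\<in>carrier V. v \<in> pos_cone V \<longleftrightarrow> \<phi> v \<in> pos_cone W))"

definition ideal_N :: "'a ordered_space \<Rightarrow> 'a \<Rightarrow> 'a set \<Rightarrow> 'a set" where
  "ideal_N V e J = {v \<in> carrier V. \<forall>r>0. \<exists>j\<in>J. \<exists>k\<in>J.
     j \<oplus>\<^bsub>V\<^esub> r \<odot>\<^bsub>V\<^esub> e \<oplus>\<^bsub>V\<^esub> v \<in> pos_cone V \<and> k \<oplus>\<^bsub>V\<^esub> r \<odot>\<^bsub>V\<^esub> e \<ominus>\<^bsub>V\<^esub> v \<in> pos_cone V}"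

definition quotient_by_ideal_N :: "'a ordered_space \<Rightarrow> 'a \<Rightarrow> 'a set \<Rightarrow> 'a set ordered_space" where
  "quotient_by_ideal_N V e J = quotient_space V (ideal_N V e J)
     {v \<in> carrier V. \<forall>r>0. \<exists>j\<in>J. j \<oplus>\<^bsub>V\<^esub> r \<odot>\<^bsub>V\<^esub> e \<oplus>\<^bsub>V\<^esub> v \<in> pos_cone V}"

end

theory Submission
  imports Defs
begin

text \<open>Let \<open>D\<close> be the set of all \<open>v\<close> such that for every \<open>r > 0\<close> some \<open>j \<in> J\<close> satisfies
  \<open>j + re + v \<in> V\<^sup>+\<close>. Everything follows from two observations about \<open>D\<close>.

  First, \<open>D\<close> is a wedge (a convex cone containing \<open>0\<close>, not necessarily proper) that contains
  \<open>V\<^sup>+\<close>, and \<open>N\<^sub>J = D \<inter> -D\<close> is its lineality space. Dividing a space by the lineality space of a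
  wedge turns the wedge into a proper cone, and membership of a coset in that cone can be tested on
  any representative (\<open>wedge.ordered_real_vector_space_quotient\<close>,
  \<open>wedge.coset_in_cone_iff\<close>). The order unit is inherited from \<open>V\<close> because
  \<open>V\<^sup>+ \<subseteq> D\<close>, and it is Archimedean because \<open>re + v \<in> D\<close> for all \<open>r > 0\<close> implies \<open>v \<in> D\<close>:
  use one half of \<open>r\<close> in the hypothesis and the other in the definition of \<open>D\<close>. That \<open>N\<^sub>J\<close> is an order ideal follows from
  \<open>V\<^sup>+ \<subseteq> D\<close> by writing \<open>-q = -p + (p - q)\<close>.

  Second, \<open>v \<in> D\<close> if and only if \<open>v + J\<close> lies in the wedge that defines the Archimedeanization
  of \<open>V/J\<close> (\<open>coset_in_arch_D_iff\<close>). Hence the composite of the two quotient maps from \<open>V\<close> onto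
  the Archimedean quotient has kernel \<open>N\<^sub>J\<close> and pulls the cone back to \<open>D\<close>, and the isomorphism
  is the one that it induces on \<open>V/N\<^sub>J\<close>
  (\<open>real_quotient.unitally_order_isomorphic_of_surjection\<close>).\<close>

lemma real_ring_simps [simp]:
  "carrier real_ring = UNIV" "\<zero>\<^bsub>real_ring\<^esub> = 0" "\<one>\<^bsub>real_ring\<^esub> = 1"
  "add real_ring = (+)" "monoid.mult real_ring = (*)"
  by (simp_all add: ring_of_type_algebra_def)

lemma (in abelian_group) a_inv_zero [simp]: "\<ominus> \<zero> = \<zero>"
  by (rule minus_equality) simp_all

section \<open>Quotients of real vector spaces\<close>

text \<open>The data for a quotient \<open>V/N\<close> with cone \<open>{v + N | v \<in> P}\<close>: \<open>N\<close> is a subspace, whereas nothing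
  is assumed of the set \<open>P\<close>, which enters only through \<open>pos_cone\<close>.\<close>

locale real_quotient = Module.module real_ring V for V :: "'a ordered_space" (structure) +
  fixes N P :: "'a set"
  assumes submodule: "submodule N real_ring V"
begin

abbreviation Q :: "'a set ordered_space" where
  "Q \<equiv> quotient_space V N P"

sublocale sub: abelian_subgroup N V
  using submodule by (intro abelian_subgroupI3 additive_subgroupI)
    (auto simp: submodule_def abelian_group_axioms)

lemma smult_mem: "x \<in> N \<Longrightarrow> r \<odot> x \<in> N"
  using submodule.smult_closed[OF submodule] by simp

lemma carrier_quotient: "carrier Q = (\<lambda>x. N +> x) ` carrier V"
  by (auto simp: quotient_space_def A_RCOSETS_def')

lemma coset_in_carrier: "x \<in> carrier V \<Longrightarrow> N +> x \<in> carrier Q"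
  by (simp add: carrier_quotient)

lemma coset_eq_iff:
  assumes "x \<in> carrier V" "y \<in> carrier V"
  shows "N +> x = N +> y \<longleftrightarrow> x \<ominus> y \<in> N"
proof -
  have "x \<in> N +> y \<longleftrightarrow> x \<ominus> y \<in> N"
    using assms sub.a_rcos_module[of y x] by (simp add: a_minus_def)
  moreover have "N +> x = N +> y \<longleftrightarrow> x \<in> N +> y"
    using assms sub.a_rcos_self[of x] sub.a_repr_independence'[of x y] by auto
  ultimately show ?thesis by simp
qed

lemma zero_quotient: "\<zero>\<^bsub>Q\<^esub> = N +> \<zero>"
  using sub.a_subset by (simp add: quotient_space_def)

lemma coset_add:
  "\<lbrakk>x \<in> carrier V; y \<in> carrier V\<rbrakk> \<Longrightarrow> (N +> x) \<oplus>\<^bsub>Q\<^esub> (N +> y) = N +> (x \<oplus> y)"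
  by (simp add: quotient_space_def sub.a_rcos_sum)

lemma coset_smult:
  assumes x: "x \<in> carrier V"
  shows "r \<odot>\<^bsub>Q\<^esub> (N +> x) = N +> (r \<odot> x)"
proof -
  have "N +> (r \<odot> y) = N +> (r \<odot> x)" if y: "y \<in> N +> x" for y
  proof -
    obtain n where n: "n \<in> N" "y = n \<oplus> x"
      using y by (auto simp: a_r_coset_def')
    have nc: "n \<in> carrier V" using n sub.a_subset by auto
    have "r \<odot> y = r \<odot> n \<oplus> r \<odot> x" using n nc x by (simp add: smult_r_distr)
    then have "r \<odot> y \<in> N +> (r \<odot> x)" using n smult_mem by (auto simp: a_r_coset_def')
    then show ?thesis using sub.a_repr_independence' x by simp
  qed
  moreover have "x \<in> N +> x" using sub.a_rcos_self x by simp
  ultimately have "(\<Union>y\<in>N +> x. N +> (r \<odot> y)) = N +> (r \<odot> x)" by blast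
  then show ?thesis by (simp add: quotient_space_def)
qed

lemma coset_in_cone_iff:
  assumes "P \<subseteq> carrier V" and x: "x \<in> carrier V"
  shows "N +> x \<in> pos_cone Q \<longleftrightarrow> (\<exists>n\<in>N. n \<oplus> x \<in> P)"
proof
  assume "N +> x \<in> pos_cone Q"
  then obtain p where "p \<in> P" "N +> x = N +> p" by (auto simp: quotient_space_def)
  moreover have "p \<in> N +> p" using calculation assms sub.a_rcos_self by auto
  ultimately show "\<exists>n\<in>N. n \<oplus> x \<in> P" by (force simp: a_r_coset_def')
next
  assume "\<exists>n\<in>N. n \<oplus> x \<in> P"
  then obtain n where n: "n \<in> N" "n \<oplus> x \<in> P" by auto
  have "n \<oplus> x \<in> N +> x" using n by (auto simp: a_r_coset_def')
  then have "N +> x = N +> (n \<oplus> x)" using sub.a_repr_independence' x by simp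
  then show "N +> x \<in> pos_cone Q" using n by (auto simp: quotient_space_def)
qed

text \<open>If \<open>P\<close> is a union of cosets of \<open>N\<close>, positivity can be tested on any representative.\<close>

lemma coset_in_saturated_cone_iff:
  assumes P: "P \<subseteq> carrier V" "\<And>n p. \<lbrakk>n \<in> N; p \<in> P\<rbrakk> \<Longrightarrow> n \<oplus> p \<in> P"
    and x: "x \<in> carrier V"
  shows "N +> x \<in> pos_cone Q \<longleftrightarrow> x \<in> P"
proof
  assume "N +> x \<in> pos_cone Q"
  then obtain n where n: "n \<in> N" "n \<oplus> x \<in> P" using coset_in_cone_iff P x by auto
  then have "\<ominus> n \<oplus> (n \<oplus> x) \<in> P" using P by blast
  then show "x \<in> P" using n x sub.a_subset by (auto simp: r_neg1)
qed (auto simp: quotient_space_def)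

lemma module_quotient: "Module.module real_ring Q"
proof (rule moduleI)
  show "cring real_ring" by (rule cring_from_type_algebra)
  show "abelian_group Q"
  proof (rule abelian_groupI)
    fix C assume "C \<in> carrier Q"
    then obtain x where x: "x \<in> carrier V" "C = N +> x" by (auto simp: carrier_quotient)
    then have "(N +> (\<ominus> x)) \<oplus>\<^bsub>Q\<^esub> C = \<zero>\<^bsub>Q\<^esub>"
      by (simp add: coset_add zero_quotient l_neg)
    then show "\<exists>D\<in>carrier Q. D \<oplus>\<^bsub>Q\<^esub> C = \<zero>\<^bsub>Q\<^esub>"
      using x coset_in_carrier by blast
  qed (auto simp: carrier_quotient zero_quotient coset_add a_ac)
qed (auto simp: carrier_quotient coset_add coset_smult smult_l_distr smult_r_distr
    smult_assoc1[simplified] smult_l_distr[simplified] smult_one[simplified])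

lemma coset_a_inv:
  assumes "x \<in> carrier V"
  shows "\<ominus>\<^bsub>Q\<^esub> (N +> x) = N +> (\<ominus> x)"
proof -
  interpret q: Module.module real_ring Q by (rule module_quotient)
  show ?thesis
    using assms
    by (intro q.M.minus_equality) (simp_all add: coset_add zero_quotient l_neg coset_in_carrier)
qed

lemma coset_minus:
  "\<lbrakk>x \<in> carrier V; y \<in> carrier V\<rbrakk> \<Longrightarrow> (N +> x) \<ominus>\<^bsub>Q\<^esub> (N +> y) = N +> (x \<ominus> y)"
  by (simp add: a_minus_def coset_a_inv coset_add)

text \<open>First isomorphism theorem for ordered spaces: a linear map \<open>f\<close> onto \<open>W\<close> whose kernel is \<open>N\<close>
  and under which \<open>P\<close> is the preimage of the cone of \<open>W\<close> induces a unital order isomorphism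
  from \<open>V/N\<close> to \<open>W\<close>.\<close>

lemma unitally_order_isomorphic_of_surjection:
  assumes P: "P \<subseteq> carrier V" "\<And>n p. \<lbrakk>n \<in> N; p \<in> P\<rbrakk> \<Longrightarrow> n \<oplus> p \<in> P"
    and e: "e \<in> carrier V" "f e = w"
    and onto: "f ` carrier V = carrier W"
    and add: "\<And>x y. \<lbrakk>x \<in> carrier V; y \<in> carrier V\<rbrakk> \<Longrightarrow> f (x \<oplus> y) = f x \<oplus>\<^bsub>W\<^esub> f y"
    and smult: "\<And>r x. x \<in> carrier V \<Longrightarrow> f (r \<odot> x) = r \<odot>\<^bsub>W\<^esub> f x"
    and ker: "\<And>x y. \<lbrakk>x \<in> carrier V; y \<in> carrier V\<rbrakk> \<Longrightarrow> f x = f y \<longleftrightarrow> x \<ominus> y \<in> N"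
    and cone: "\<And>x. x \<in> carrier V \<Longrightarrow> f x \<in> pos_cone W \<longleftrightarrow> x \<in> P"
  shows "unitally_order_isomorphic Q (N +> e) W w"
proof -
  define \<phi> where "\<phi> = (\<lambda>C. f (SOME x. x \<in> C))"
  have \<phi>: "\<phi> (N +> x) = f x" if x: "x \<in> carrier V" for x
  proof -
    define y where "y = (SOME y. y \<in> N +> x)"
    have y: "y \<in> N +> x" unfolding y_def using sub.a_rcos_self x by (metis someI)
    moreover have yc: "y \<in> carrier V"
      using y x sub.a_subset by (auto simp: a_r_coset_def')
    ultimately have "N +> x = N +> y" using sub.a_repr_independence' x by simp
    then have "f y = f x" using coset_eq_iff ker x yc by metis
    then show ?thesis by (simp add: \<phi>_def y_def)
  qed
  have "bij_betw \<phi> (carrier Q) (carrier W)"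
    unfolding bij_betw_def
  proof
    show "inj_on \<phi> (carrier Q)"
    proof (rule inj_onI)
      fix C D assume "C \<in> carrier Q" "D \<in> carrier Q" "\<phi> C = \<phi> D"
      moreover from this obtain x y where "x \<in> carrier V" "C = N +> x" "y \<in> carrier V" "D = N +> y"
        by (auto simp: carrier_quotient)
      ultimately show "C = D" by (simp add: \<phi> ker coset_eq_iff)
    qed
    show "\<phi> ` carrier Q = carrier W"
      by (simp add: carrier_quotient image_image \<phi> flip: onto)
  qed
  then show ?thesis
    unfolding unitally_order_isomorphic_def
    using e by (intro exI[of _ \<phi>])
      (auto simp: carrier_quotient coset_add coset_smult \<phi> add smult cone coset_in_saturated_cone_iff[OF P])
qed

end

section \<open>Wedges and their lineality spaces\<close>

text \<open>A wedge satisfies the axioms of a positive cone except for \<open>P \<inter> -P = {0}\<close>.\<close>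

locale wedge = Module.module real_ring V for V :: "'a ordered_space" (structure) +
  fixes P :: "'a set"
  assumes subset: "P \<subseteq> carrier V"
    and zero: "\<zero> \<in> P"
    and add: "\<lbrakk>x \<in> P; y \<in> P\<rbrakk> \<Longrightarrow> x \<oplus> y \<in> P"
    and smult: "\<lbrakk>0 \<le> r; x \<in> P\<rbrakk> \<Longrightarrow> r \<odot> x \<in> P"
begin

text \<open>The largest subspace contained in the wedge.\<close>

definition lineality :: "'a set" where
  "lineality = P \<inter> {\<ominus> v | v. v \<in> P}"

lemma lineality_iff: "x \<in> lineality \<longleftrightarrow> x \<in> P \<and> \<ominus> x \<in> P"
proof -
  have "\<ominus> (\<ominus> v) = v" if "v \<in> P" for v
    using that subset by auto
  then show ?thesis unfolding lineality_def by auto metis+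
qed

lemma submodule_lineality: "submodule lineality real_ring V"
proof (rule submoduleI)
  fix r x assume x: "x \<in> lineality"
  have xc: "x \<in> carrier V" using x subset by (auto simp: lineality_iff)
  have inv: "\<ominus> (r \<odot> x) = (- r) \<odot> x" "r \<odot> x = (- r) \<odot> (\<ominus> x)"
    "\<ominus> (r \<odot> x) = r \<odot> (\<ominus> x)"
  proof -
    have "(- r) \<odot> x \<oplus> r \<odot> x = \<zero>"
      using smult_l_distr[of "- r" r x] smult_l_null[of x] xc by simp
    then show 1: "\<ominus> (r \<odot> x) = (- r) \<odot> x" using xc by (intro minus_equality) auto
    show 2: "\<ominus> (r \<odot> x) = r \<odot> (\<ominus> x)" using xc by (simp add: smult_r_minus)
    show "r \<odot> x = (- r) \<odot> (\<ominus> x)"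
      using smult_r_minus[of "- r" x] xc by (simp flip: 1)
  qed
  \<comment> \<open>The wedge absorbs nonnegative scalars only; for \<open>r < 0\<close>, move the sign over to \<open>x\<close>.\<close>
  show "r \<odot> x \<in> lineality"
  proof (cases "0 \<le> r")
    case True
    then show ?thesis using x smult unfolding lineality_iff inv(3) by auto
  next
    case False
    then have "0 \<le> - r" by simp
    then show ?thesis using x smult[of "- r"] inv unfolding lineality_iff by metis
  qed
next
  fix x y assume xy: "x \<in> lineality" "y \<in> lineality"
  then have "x \<in> carrier V" "y \<in> carrier V" using subset by (auto simp: lineality_iff)
  then show "x \<oplus> y \<in> lineality"
    using xy add by (simp add: lineality_iff minus_add)
qed (use subset zero in \<open>auto simp: lineality_iff\<close>)

sublocale quot: real_quotient V lineality P
  by (intro real_quotient.intro real_quotient_axioms.intro module_axioms submodule_lineality)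

lemma lineality_add: "\<lbrakk>n \<in> lineality; p \<in> P\<rbrakk> \<Longrightarrow> n \<oplus> p \<in> P"
  using add by (simp add: lineality_iff)

lemmas coset_in_cone_iff = quot.coset_in_saturated_cone_iff[OF subset lineality_add]

lemma ordered_real_vector_space_quotient:
  "ordered_real_vector_space (quotient_space V lineality P)"
proof -
  let ?Q = "quotient_space V lineality P"
  interpret q: Module.module real_ring ?Q by (rule quot.module_quotient)
  have cone: "pos_cone ?Q = (\<lambda>x. lineality +> x) ` P"
    by (auto simp: quotient_space_def)
  show ?thesis
  proof
    show "pos_cone ?Q \<subseteq> carrier ?Q"
      using subset by (auto simp: cone quot.carrier_quotient)
    show "pos_cone ?Q \<noteq> {}"
      using zero by (auto simp: cone)
    show "C \<oplus>\<^bsub>?Q\<^esub> D \<in> pos_cone ?Q" if "C \<in> pos_cone ?Q" "D \<in> pos_cone ?Q" for C D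
    proof -
      obtain x y where "x \<in> P" "C = lineality +> x" "y \<in> P" "D = lineality +> y"
        using \<open>C \<in> pos_cone ?Q\<close> \<open>D \<in> pos_cone ?Q\<close> unfolding cone by blast
      then have "C \<oplus>\<^bsub>?Q\<^esub> D = lineality +> (x \<oplus> y)" "x \<oplus> y \<in> P"
        using add subset by (simp_all add: quot.coset_add subsetD)
      then show ?thesis unfolding cone by simp
    qed
    show "r \<odot>\<^bsub>?Q\<^esub> C \<in> pos_cone ?Q" if "0 \<le> r" "C \<in> pos_cone ?Q" for r C
    proof -
      obtain x where "x \<in> P" "C = lineality +> x"
        using \<open>C \<in> pos_cone ?Q\<close> unfolding cone by blast
      then have "r \<odot>\<^bsub>?Q\<^esub> C = lineality +> (r \<odot> x)" "r \<odot> x \<in> P"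
        using \<open>0 \<le> r\<close> smult subset by (simp_all add: quot.coset_smult subsetD)
      then show ?thesis unfolding cone by simp
    qed
    show "pos_cone ?Q \<inter> {\<ominus>\<^bsub>?Q\<^esub> C | C. C \<in> pos_cone ?Q} = {\<zero>\<^bsub>?Q\<^esub>}"
    proof
      show "{\<zero>\<^bsub>?Q\<^esub>} \<subseteq> pos_cone ?Q \<inter> {\<ominus>\<^bsub>?Q\<^esub> C | C. C \<in> pos_cone ?Q}"
      proof -
        have "\<zero>\<^bsub>?Q\<^esub> \<in> pos_cone ?Q"
          using zero by (simp add: cone quot.zero_quotient)
        moreover have "\<zero>\<^bsub>?Q\<^esub> = \<ominus>\<^bsub>?Q\<^esub> \<zero>\<^bsub>?Q\<^esub>" by simp
        ultimately show ?thesis by blast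
      qed
      show "pos_cone ?Q \<inter> {\<ominus>\<^bsub>?Q\<^esub> C | C. C \<in> pos_cone ?Q} \<subseteq> {\<zero>\<^bsub>?Q\<^esub>}"
      proof
        fix C assume "C \<in> pos_cone ?Q \<inter> {\<ominus>\<^bsub>?Q\<^esub> C | C. C \<in> pos_cone ?Q}"
        then obtain x y where x: "x \<in> P" "C = lineality +> x"
          and y: "y \<in> P" "C = \<ominus>\<^bsub>?Q\<^esub> (lineality +> y)"
          unfolding cone by blast
        have c: "x \<in> carrier V" "y \<in> carrier V" using x y subset by auto
        have "lineality +> (\<ominus> x) = \<ominus>\<^bsub>?Q\<^esub> C"
          using x c by (simp add: quot.coset_a_inv)
        also have "\<dots> = lineality +> y"
          using y c by (simp add: quot.coset_a_inv)
        finally have "lineality +> (\<ominus> x) \<in> pos_cone ?Q" using y by (simp add: cone)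
        then have "\<ominus> x \<in> P" using coset_in_cone_iff c by simp
        then have "x \<ominus> \<zero> \<in> lineality" using x c by (simp add: lineality_iff a_minus_def)
        then show "C \<in> {\<zero>\<^bsub>?Q\<^esub>}"
          using x c quot.coset_eq_iff[of x \<zero>] by (simp add: quot.zero_quotient)
      qed
    qed
  qed
qed

end

section \<open>Archimedeanization modulo a subspace\<close>

text \<open>A subspace \<open>J\<close> of an ordered real vector space \<open>V\<close> with order unit \<open>e\<close>.\<close>

locale unital_quotient = ordered_real_vector_space V for V :: "'a ordered_space" (structure) +
  fixes e :: 'a and J :: "'a set"
  assumes unit: "order_unit V e"
    and ideal: "submodule J real_ring V"
begin

text \<open>The elements that are nonnegative modulo \<open>J\<close> up to arbitrarily small positive multiples
  of \<open>e\<close>; \<open>j\<close> may depend on \<open>r\<close>.\<close>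

definition D :: "'a set" where
  "D = {v \<in> carrier V. \<forall>r>0. \<exists>j\<in>J. j \<oplus> r \<odot> e \<oplus> v \<in> pos_cone V}"

sublocale J: real_quotient V J "pos_cone V"
  by (intro real_quotient.intro real_quotient_axioms.intro module_axioms ideal)

abbreviation U :: "'a set ordered_space" where
  "U \<equiv> order_quotient V J"

lemma e_carrier [simp]: "e \<in> carrier V"
  using unit by (simp add: order_unit_def)

lemma J_carrier: "j \<in> J \<Longrightarrow> j \<in> carrier V"
  using J.sub.a_subset by auto

lemma cone_zero: "\<zero> \<in> pos_cone V"
  using cone_proper by auto

lemma unit_in_cone: "e \<in> pos_cone V"
proof -
  obtain r where r: "r > 0" "r \<odot> e \<ominus> \<zero> \<in> pos_cone V"
    using unit by (force simp: order_unit_def geq_def)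
  then have "(1 / r) \<odot> (r \<odot> e) \<in> pos_cone V"
    using cone_smult[of "1 / r" "r \<odot> e"] by (simp add: a_minus_def)
  moreover have "(1 / r) \<odot> (r \<odot> e) = e"
    using smult_assoc1[of "1 / r" r e] smult_one[simplified, of e] r(1) by simp
  ultimately show ?thesis by simp
qed

lemma cone_subset_D: "pos_cone V \<subseteq> D"
proof
  fix v assume v: "v \<in> pos_cone V"
  have "\<zero> \<oplus> r \<odot> e \<oplus> v \<in> pos_cone V" if "r > 0" for r
    using v that cone_add cone_smult unit_in_cone by simp
  then show "v \<in> D"
    using v cone_subset J.sub.zero_closed unfolding D_def by blast
qed

lemma smult_split: "r \<odot> e = (r / 2) \<odot> e \<oplus> (r / 2) \<odot> e"
  using smult_l_distr[of "r / 2" "r / 2" e] by simp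

sublocale D: wedge V D
proof
  show "D \<subseteq> carrier V" by (auto simp: D_def)
  show zero: "\<zero> \<in> D" using cone_subset_D cone_zero by auto
  show "x \<oplus> y \<in> D" if x: "x \<in> D" and y: "y \<in> D" for x y
  proof -
    have c: "x \<in> carrier V" "y \<in> carrier V" using x y by (auto simp: D_def)
    have "\<exists>j\<in>J. j \<oplus> r \<odot> e \<oplus> (x \<oplus> y) \<in> pos_cone V" if r: "r > 0" for r
    proof -
      have "r / 2 > 0" using r by simp
      then obtain j k where j: "j \<in> J" "j \<oplus> (r / 2) \<odot> e \<oplus> x \<in> pos_cone V"
        and k: "k \<in> J" "k \<oplus> (r / 2) \<odot> e \<oplus> y \<in> pos_cone V"
        using x y unfolding D_def by blast
      have "(j \<oplus> (r / 2) \<odot> e \<oplus> x) \<oplus> (k \<oplus> (r / 2) \<odot> e \<oplus> y) = (j \<oplus> k) \<oplus> r \<odot> e \<oplus> (x \<oplus> y)"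
        unfolding smult_split[of r]
        using c j k J_carrier by (simp add: a_ac)
      then show ?thesis using cone_add j k J.sub.a_closed by metis
    qed
    then show ?thesis using c by (simp add: D_def)
  qed
  show "s \<odot> x \<in> D" if s: "0 \<le> s" and x: "x \<in> D" for s x
  proof (cases "s = 0")
    case True
    then show ?thesis using zero x smult_l_null[of x] by (simp add: D_def)
  next
    case False
    then have s: "s > 0" using s by simp
    have c: "x \<in> carrier V" using x by (auto simp: D_def)
    have "\<exists>j\<in>J. j \<oplus> r \<odot> e \<oplus> s \<odot> x \<in> pos_cone V" if r: "r > 0" for r
    proof -
      have "r / s > 0" using r s by simp
      then obtain j where j: "j \<in> J" "j \<oplus> (r / s) \<odot> e \<oplus> x \<in> pos_cone V"
        using x unfolding D_def by blast
      have "s \<odot> (j \<oplus> (r / s) \<odot> e \<oplus> x) = s \<odot> j \<oplus> r \<odot> e \<oplus> s \<odot> x"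
        using j J_carrier c s smult_assoc1[of s "r / s" e] by (simp add: smult_r_distr)
      then show ?thesis using cone_smult[of s] j s J.smult_mem
        by (metis less_eq_real_def)
    qed
    then show ?thesis using c by (simp add: D_def)
  qed
qed

lemma ideal_N_eq: "ideal_N V e J = D.lineality"
proof (rule Set.set_eqI)
  fix v
  show "v \<in> ideal_N V e J \<longleftrightarrow> v \<in> D.lineality"
    unfolding D.lineality_iff by (auto simp: ideal_N_def D_def a_minus_def)
qed

lemma quotient_by_ideal_N_eq: "quotient_by_ideal_N V e J = quotient_space V D.lineality D"
  by (simp add: quotient_by_ideal_N_def ideal_N_eq D_def)

lemma order_ideal_lineality: "order_ideal V D.lineality"
  unfolding order_ideal_def
proof (intro conjI ballI impI)
  show "submodule D.lineality real_ring V" by (rule D.submodule_lineality)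
  fix p q assume p: "p \<in> D.lineality" and q: "q \<in> carrier V"
    and "q \<succeq> \<zero> \<and> p \<succeq> q"
  then have "q \<in> D" "p \<ominus> q \<in> D"
    using cone_subset_D by (auto simp: geq_def a_minus_def)
  moreover have "\<ominus> p \<in> D" "p \<in> carrier V"
    using p D.subset by (auto simp: D.lineality_iff)
  moreover have "\<ominus> q = \<ominus> p \<oplus> (p \<ominus> q)"
    using q calculation by (simp add: a_minus_def r_neg1)
  ultimately show "q \<in> D.lineality"
    using D.add by (simp add: D.lineality_iff)
qed

lemma archimedean_order_unit_quotient:
  "archimedean_order_unit (quotient_space V D.lineality D) (D.lineality +> e)"
proof -
  let ?Q = "quotient_space V D.lineality D"
  interpret q: ordered_real_vector_space ?Q by (rule D.ordered_real_vector_space_quotient)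
  have "\<exists>r>0. r \<odot>\<^bsub>?Q\<^esub> (D.lineality +> e) \<succeq>\<^bsub>?Q\<^esub> C" if C: "C \<in> carrier ?Q" for C
  proof -
    obtain v where v: "v \<in> carrier V" "C = D.lineality +> v"
      using C by (auto simp: D.quot.carrier_quotient)
    obtain r where r: "r > 0" "r \<odot> e \<ominus> v \<in> pos_cone V"
      using unit v by (force simp: order_unit_def geq_def)
    then have "r \<odot> e \<ominus> v \<in> D" using cone_subset_D by auto
    then have "r \<odot>\<^bsub>?Q\<^esub> (D.lineality +> e) \<succeq>\<^bsub>?Q\<^esub> C"
      using v by (simp add: geq_def D.quot.coset_smult D.quot.coset_minus D.coset_in_cone_iff)
    then show ?thesis using r by blast
  qed
  moreover have "C \<in> pos_cone ?Q"
    if C: "C \<in> carrier ?Q"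
      and pos: "\<forall>r>0. r \<odot>\<^bsub>?Q\<^esub> (D.lineality +> e) \<oplus>\<^bsub>?Q\<^esub> C \<succeq>\<^bsub>?Q\<^esub> \<zero>\<^bsub>?Q\<^esub>" for C
  proof -
    obtain v where v: "v \<in> carrier V" "C = D.lineality +> v"
      using C by (auto simp: D.quot.carrier_quotient)
    \<comment> \<open>Coset by coset, the hypothesis only says that each \<open>re + v\<close> lies in \<open>D\<close>; a second
      positive multiple of \<open>e\<close> is needed to reach \<open>V\<^sup>+\<close>, so \<open>r\<close> is split in two halves.\<close>
    have vD: "r \<odot> e \<oplus> v \<in> D" if "r > 0" for r
    proof -
      have "r \<odot> e \<oplus> v \<ominus> \<zero> \<in> D"
        using pos that v
        by (simp add: geq_def D.quot.coset_smult D.quot.coset_add D.quot.zero_quotient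
            D.quot.coset_minus D.coset_in_cone_iff)
      then show ?thesis using v by (simp add: a_minus_def)
    qed
    have "\<exists>j\<in>J. j \<oplus> r \<odot> e \<oplus> v \<in> pos_cone V" if r: "r > 0" for r
    proof -
      have "r / 2 > 0" using r by simp
      with vD obtain j where j: "j \<in> J" "j \<oplus> (r / 2) \<odot> e \<oplus> ((r / 2) \<odot> e \<oplus> v) \<in> pos_cone V"
        unfolding D_def by blast
      moreover have "j \<oplus> (r / 2) \<odot> e \<oplus> ((r / 2) \<odot> e \<oplus> v) = j \<oplus> r \<odot> e \<oplus> v"
        unfolding smult_split[of r] using j J_carrier v by (simp add: a_assoc)
      ultimately show ?thesis by auto
    qed
    then have "v \<in> D" using v by (simp add: D_def)
    then show ?thesis using v D.coset_in_cone_iff by simp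
  qed
  ultimately show ?thesis
    unfolding archimedean_order_unit_def order_unit_def
    using D.quot.coset_in_carrier by simp
qed

text \<open>The wedge \<open>arch_D\<close> of \<open>V/J\<close> pulls back to \<open>D\<close>: for each \<open>r\<close>, the coset of \<open>re + v\<close> is positive in
  \<open>V/J\<close> exactly when some \<open>j + re + v\<close> with \<open>j \<in> J\<close> is positive in \<open>V\<close>.\<close>

lemma coset_in_arch_D_iff:
  assumes v: "v \<in> carrier V"
  shows "J +> v \<in> arch_D U (J +> e) \<longleftrightarrow> v \<in> D"
proof -
  have "r \<odot>\<^bsub>U\<^esub> (J +> e) \<oplus>\<^bsub>U\<^esub> (J +> v) \<in> pos_cone U \<longleftrightarrow>
      (\<exists>j\<in>J. j \<oplus> r \<odot> e \<oplus> v \<in> pos_cone V)" for r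
  proof -
    have "(\<exists>j\<in>J. j \<oplus> (r \<odot> e \<oplus> v) \<in> pos_cone V) \<longleftrightarrow> (\<exists>j\<in>J. j \<oplus> r \<odot> e \<oplus> v \<in> pos_cone V)"
      using v J_carrier by (intro bex_cong) (simp_all add: a_assoc)
    then show ?thesis
      using v cone_subset
      by (simp add: order_quotient_def J.coset_smult J.coset_add J.coset_in_cone_iff)
  qed
  then show ?thesis
    using v J.coset_in_carrier unfolding arch_D_def D_def order_quotient_def by simp
qed

lemma arch_D_eq: "arch_D U (J +> e) = (\<lambda>v. J +> v) ` D"
proof
  show "(\<lambda>v. J +> v) ` D \<subseteq> arch_D U (J +> e)"
    using coset_in_arch_D_iff D.subset by auto
  show "arch_D U (J +> e) \<subseteq> (\<lambda>v. J +> v) ` D"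
  proof
    fix C assume C: "C \<in> arch_D U (J +> e)"
    then obtain v where "v \<in> carrier V" "C = J +> v"
      by (auto simp: arch_D_def order_quotient_def J.carrier_quotient)
    then show "C \<in> (\<lambda>v. J +> v) ` D" using C coset_in_arch_D_iff by auto
  qed
qed

sublocale U: wedge U "arch_D U (J +> e)"
proof -
  interpret u: Module.module real_ring U
    unfolding order_quotient_def by (rule J.module_quotient)
  show "wedge U (arch_D U (J +> e))"
  proof
    show "arch_D U (J +> e) \<subseteq> carrier U" by (auto simp: arch_D_def)
    show "\<zero>\<^bsub>U\<^esub> \<in> arch_D U (J +> e)"
    proof -
      have "\<zero>\<^bsub>U\<^esub> = J +> \<zero>" by (simp add: order_quotient_def J.zero_quotient)
      then show ?thesis using D.zero unfolding arch_D_eq by simp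
    qed
    show "B \<oplus>\<^bsub>U\<^esub> C \<in> arch_D U (J +> e)"
      if "B \<in> arch_D U (J +> e)" "C \<in> arch_D U (J +> e)" for B C
    proof -
      obtain x y where "x \<in> D" "B = J +> x" "y \<in> D" "C = J +> y"
        using \<open>B \<in> _\<close> \<open>C \<in> _\<close> unfolding arch_D_eq by blast
      then have "B \<oplus>\<^bsub>U\<^esub> C = J +> (x \<oplus> y)" "x \<oplus> y \<in> D"
        using D.add D.subset by (simp_all add: J.coset_add subsetD order_quotient_def)
      then show ?thesis unfolding arch_D_eq by simp
    qed
    show "r \<odot>\<^bsub>U\<^esub> C \<in> arch_D U (J +> e)" if "0 \<le> r" "C \<in> arch_D U (J +> e)" for r C
    proof -
      obtain x where "x \<in> D" "C = J +> x"
        using \<open>C \<in> _\<close> unfolding arch_D_eq by blast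
      then have "r \<odot>\<^bsub>U\<^esub> C = J +> (r \<odot> x)" "r \<odot> x \<in> D"
        using \<open>0 \<le> r\<close> D.smult D.subset by (simp_all add: J.coset_smult subsetD order_quotient_def)
      then show ?thesis unfolding arch_D_eq by simp
    qed
  qed
qed

lemma arch_N_eq: "arch_N U (J +> e) = U.lineality"
  by (simp add: arch_N_def U.lineality_def)

lemma coset_in_arch_N_iff:
  assumes "v \<in> carrier V"
  shows "J +> v \<in> U.lineality \<longleftrightarrow> v \<in> D.lineality"
proof -
  have "\<ominus>\<^bsub>U\<^esub> (J +> v) = J +> (\<ominus> v)"
    using assms by (simp add: order_quotient_def J.coset_a_inv)
  then show ?thesis
    using assms by (simp add: U.lineality_iff D.lineality_iff coset_in_arch_D_iff)
qed

lemma archimedean_quotient_isomorphic: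
  "unitally_order_isomorphic (quotient_space V D.lineality D) (D.lineality +> e)
     (archimedean_quotient V e J) (archimedean_quotient_unit V e J)"
proof (rule D.quot.unitally_order_isomorphic_of_surjection
    [where f = "\<lambda>v. U.lineality +>\<^bsub>U\<^esub> (J +> v)"])
  have W: "archimedean_quotient V e J = quotient_space U U.lineality (arch_D U (J +> e))"
    by (simp add: archimedean_quotient_def archimedeanization_def arch_N_eq)
  have Uc: "carrier U = (\<lambda>v. J +> v) ` carrier V"
    by (simp add: order_quotient_def J.carrier_quotient)
  then have Jc: "J +> v \<in> carrier U" if "v \<in> carrier V" for v using that by simp
  note [simp] = W Jc
  show "D \<subseteq> carrier V" by (rule D.subset)
  show "n \<oplus> p \<in> D" if "n \<in> D.lineality" "p \<in> D" for n p
    using that by (rule D.lineality_add)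
  show "e \<in> carrier V" by simp
  show "U.lineality +>\<^bsub>U\<^esub> (J +> e) = archimedean_quotient_unit V e J"
    by (simp add: archimedean_quotient_unit_def archimedeanization_unit_def arch_N_eq)
  show "(\<lambda>v. U.lineality +>\<^bsub>U\<^esub> (J +> v)) ` carrier V = carrier (archimedean_quotient V e J)"
    by (simp add: U.quot.carrier_quotient Uc image_image)
  fix x y assume x: "x \<in> carrier V"
  show "U.lineality +>\<^bsub>U\<^esub> (J +> (r \<odot> x)) =
      r \<odot>\<^bsub>archimedean_quotient V e J\<^esub> (U.lineality +>\<^bsub>U\<^esub> (J +> x))" for r
    using x J.coset_smult by (simp add: U.quot.coset_smult flip: order_quotient_def)
  show "U.lineality +>\<^bsub>U\<^esub> (J +> x) \<in> pos_cone (archimedean_quotient V e J) \<longleftrightarrow> x \<in> D"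
    using x by (simp add: U.coset_in_cone_iff coset_in_arch_D_iff)
  assume y: "y \<in> carrier V"
  show "U.lineality +>\<^bsub>U\<^esub> (J +> (x \<oplus> y)) =
      (U.lineality +>\<^bsub>U\<^esub> (J +> x)) \<oplus>\<^bsub>archimedean_quotient V e J\<^esub> (U.lineality +>\<^bsub>U\<^esub> (J +> y))"
    using x y J.coset_add by (simp add: U.quot.coset_add flip: order_quotient_def)
  have "(J +> x) \<ominus>\<^bsub>U\<^esub> (J +> y) = J +> (x \<ominus> y)"
    using x y J.coset_minus by (simp add: order_quotient_def)
  then show "U.lineality +>\<^bsub>U\<^esub> (J +> x) = U.lineality +>\<^bsub>U\<^esub> (J +> y) \<longleftrightarrow> x \<ominus> y \<in> D.lineality"
    using x y by (simp add: U.quot.coset_eq_iff coset_in_arch_N_iff)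
qed

end

theorem proposition2p44:
  fixes V :: "'a ordered_space" and e :: 'a and J :: "'a set"
  assumes "ordered_real_vector_space V"
    and "order_unit V e"
    and "order_ideal V J"
  shows "order_ideal V (ideal_N V e J) \<and>
    ordered_real_vector_space (quotient_by_ideal_N V e J) \<and>
    archimedean_order_unit (quotient_by_ideal_N V e J) (ideal_N V e J +>\<^bsub>V\<^esub> e) \<and>
    unitally_order_isomorphic
      (quotient_by_ideal_N V e J) (ideal_N V e J +>\<^bsub>V\<^esub> e)
      (archimedean_quotient V e J) (archimedean_quotient_unit V e J)"
proof -
  interpret unital_quotient V e J
    using assms by (intro unital_quotient.intro unital_quotient_axioms.intro)
      (auto simp: order_ideal_def)
  show ?thesis
    unfolding quotient_by_ideal_N_eq ideal_N_eq
    using order_ideal_lineality D.ordered_real_vector_space_quotient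
      archimedean_order_unit_quotient archimedean_quotient_isomorphic by simp
qed

end
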